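(* Let $n = 2^k p$, where $p$ is an odd prime and $k \in \mathbb{N}$. Then $n$ is a solution of the congruence $$\binom{2n}{n} \equiv 2^n \pmod n$$ if and only if $p$ satisfies both of the following conditions: (a) $p$ divides $\binom{2^{k+1}}{2^k} - 2^{2^k}$; (b) the binary expansion of $p$ has at least $k$ digits equal to $1$. *)

theory Defs
  imports "HOL-Number_Theory.Number_Theory"
begin

definition binary_ones :: "nat \<Rightarrow> nat" where
  "binary_ones m = card {i. bit m i}"

end

(*
  Both sides are compared modulo the coprime factors p and 2^k of n. Modulo p, Lucas' congruence
  and Fermat's little theorem strip the factor p from the binomial coefficient and from the
  exponent. Modulo 2^k the power 2^n vanishes, while by Kummer (Legendre) the exponent of 2 in
  binom(2n, n) is the number of binary ones of n, which equals that of p.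
*)
theory Submission
  imports Defs
begin

text \<open>\<open>card\<close> is 0 on infinite sets, so counting an extra digit needs finiteness.
  A one at position \<open>i\<close> forces \<open>2 ^ i \<le> m\<close>, and
  \<open>i < 2 ^ i\<close>.\<close>

lemma finite_bits_nat: "finite {i. bit (m :: nat) i}"
proof (rule finite_subset)
  show "{i. bit m i} \<subseteq> {..<m}"
  proof
    fix i assume "i \<in> {i. bit m i}"
    then have "m div 2 ^ i \<noteq> 0"
      by (auto simp: bit_iff_odd intro: odd_pos)
    then have "2 ^ i \<le> m"
      by (meson div_less not_le)
    then show "i \<in> {..<m}"
      by (metis lessThan_iff less_exp order_less_le_trans)
  qed
qed simp

lemma binary_ones_double: "binary_ones (2 * m) = binary_ones m"
proof -
  have "{i. bit (2 * m) i} = Suc ` {i. bit m i}"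
    by (auto simp: bit_double_iff image_iff Suc_le_eq gr0_conv_Suc)
  then show ?thesis
    by (simp add: binary_ones_def card_image)
qed

lemma binary_ones_double_Suc: "binary_ones (Suc (2 * m)) = Suc (binary_ones m)"
proof -
  have "bit (Suc (2 * m)) i \<longleftrightarrow> i = 0 \<or> i \<in> Suc ` {i. bit m i}" for i
    by (cases i) (auto simp: bit_0 bit_Suc)
  then have "{i. bit (Suc (2 * m)) i} = insert 0 (Suc ` {i. bit m i})"
    by auto
  then show ?thesis
    by (simp add: binary_ones_def card_image finite_bits_nat)
qed

lemma binary_ones_power_mult: "binary_ones (2 ^ k * m) = binary_ones m"
  by (induction k) (simp_all add: binary_ones_double mult.assoc)

text \<open>Carrying: if \<open>m\<close> ends in exactly t ones, then incrementing clears them and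
  sets the zero above, and t is the exponent of 2 in \<open>Suc m\<close>.\<close>

lemma binary_ones_Suc:
  "binary_ones (Suc m) + multiplicity 2 (Suc m) = Suc (binary_ones m)"
proof (induction m rule: less_induct)
  case (less m)
  show ?case
  proof (cases "even m")
    case True
    then obtain j where j: "m = 2 * j" ..
    then have "multiplicity 2 (Suc m) = 0"
      by (intro not_dvd_imp_multiplicity_0) simp
    then show ?thesis
      by (simp add: j binary_ones_double binary_ones_double_Suc)
  next
    case False
    then obtain j where j: "m = Suc (2 * j)"
      by (auto elim: oddE)
    \<comment> \<open>The carry moves on to \<open>j\<close>: the extra factor 2 of
      \<open>Suc m\<close> accounts for the last one of \<open>m\<close>.\<close>
    have "multiplicity 2 (2 * Suc j) = Suc (multiplicity 2 (Suc j))"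
      by (rule multiplicity_times_same) simp_all
    moreover have "Suc m = 2 * Suc j"
      by (simp add: j)
    ultimately show ?thesis
      using less.IH[of j] by (simp only: binary_ones_double) (simp add: j binary_ones_double_Suc)
  qed
qed

text \<open>Absorption is applied twice, with the symmetry of row \<open>Suc (2 * m)\<close> in
  between. The division-free form lets exponents of 2 be read off both sides.\<close>

lemma central_binomial_Suc:
  "Suc m * (2 * Suc m choose Suc m) = 2 * (Suc (2 * m) * (2 * m choose m))"
proof -
  have "Suc m * (2 * Suc m choose Suc m) = 2 * Suc m * (Suc (2 * m) choose m)"
    using Suc_times_binomial_eq[of "Suc (2 * m)" m] by (simp add: mult.commute)
  also have "Suc (2 * m) choose m = Suc (2 * m) choose Suc m"
    using binomial_symmetric[of m "Suc (2 * m)"] by simp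
  also have "2 * Suc m * (Suc (2 * m) choose Suc m) = 2 * (Suc (2 * m) * (2 * m choose m))"
    using Suc_times_binomial_eq[of "2 * m" m] by (simp add: mult_ac)
  finally show ?thesis .
qed

text \<open>Both sides change by 1 minus the exponent of 2 in \<open>Suc m\<close> when
  \<open>m\<close> is incremented: on the left by the recurrence, where \<open>Suc (2 * m)\<close>
  is odd, on the right by the carry count.\<close>

lemma multiplicity_2_central_binomial: "multiplicity 2 (2 * m choose m) = binary_ones m"
proof (induction m)
  case 0
  then show ?case by (simp add: binary_ones_def)
next
  case (Suc m)
  have "multiplicity 2 (Suc m) + multiplicity 2 (2 * Suc m choose Suc m)
      = multiplicity 2 (Suc m * (2 * Suc m choose Suc m))"
    by (subst prime_elem_multiplicity_mult_distrib) simp_all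
  also have "\<dots> = multiplicity 2 (2 * (Suc (2 * m) * (2 * m choose m)))"
    by (simp only: central_binomial_Suc)
  also have "\<dots> = Suc (multiplicity 2 (Suc (2 * m) * (2 * m choose m)))"
    by (rule multiplicity_times_same) simp_all
  also have "multiplicity 2 (Suc (2 * m) * (2 * m choose m))
      = multiplicity 2 (Suc (2 * m)) + multiplicity 2 (2 * m choose m)"
    by (rule prime_elem_multiplicity_mult_distrib) simp_all
  also have "multiplicity 2 (Suc (2 * m)) = 0"
    by (rule not_dvd_imp_multiplicity_0) simp
  finally show ?case
    using Suc binary_ones_Suc[of m] by simp
qed

text \<open>Vandermonde's convolution with all but its two extreme terms divisible by \<open>p\<close>.\<close>
lemma cong_choose_add_prime:
  fixes p :: nat
  assumes "prime p"
  shows "[(p + m) choose (p + r) = (m choose (p + r)) + (m choose r)] (mod p)"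
proof -
  let ?f = "\<lambda>i. (p choose i) * (m choose (p + r - i))"
  have "0 < p"
    using assms by (rule prime_gt_0_nat)
  have "(p + m) choose (p + r) = sum ?f {..p + r}"
    by (rule vandermonde[symmetric])
  also have "\<dots> = sum ?f {0, p} + sum ?f ({..p + r} - {0, p})"
    by (rule sum.subset_diff[THEN trans, OF _ _ add.commute]) auto
  \<comment> \<open>Since \<open>0 < p\<close>, the indices 0 and \<open>p\<close> are distinct and
    contribute one term each.\<close>
  also have "sum ?f {0, p} = (m choose (p + r)) + (m choose r)"
    using \<open>0 < p\<close> by simp
  finally have eq: "(p + m) choose (p + r)
      = (m choose (p + r)) + (m choose r) + sum ?f ({..p + r} - {0, p})" .
  have "p dvd sum ?f ({..p + r} - {0, p})"
  proof (rule dvd_sum)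
    fix i assume "i \<in> {..p + r} - {0, p}"
    then consider "0 < i" "i < p" | "p < i"
      by fastforce
    then show "p dvd ?f i"
      using assms \<open>0 < p\<close> by cases (simp_all add: dvd_choose_prime binomial_eq_0)
  qed
  then show ?thesis
    unfolding eq by (simp add: cong_altdef_nat)
qed

text \<open>Modulo \<open>p\<close>, the preceding congruence with \<open>r = p * c\<close> is
  Pascal's rule for the multiples of \<open>p\<close>. Its two terms have different lower indices,
  hence the induction with \<open>b\<close> arbitrary.\<close>

lemma cong_choose_mult_prime:
  fixes p :: nat
  assumes "prime p"
  shows "[(p * a) choose (p * b) = a choose b] (mod p)"
proof (induction a arbitrary: b)
  case 0
  then show ?case
    using prime_gt_0_nat[OF assms] by (cases b) (auto simp: binomial_eq_0)
next
  case (Suc a)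
  show ?case
  proof (cases b)
    case 0
    then show ?thesis by simp
  next
    case (Suc c)
    have "[(p + p * a) choose (p + p * c) = (p * a choose (p + p * c)) + (p * a choose (p * c))] (mod p)"
      by (rule cong_choose_add_prime[OF assms])
    also have "[(p * a choose (p + p * c)) + (p * a choose (p * c)) = (a choose Suc c) + (a choose c)] (mod p)"
      using Suc.IH[of "Suc c"] Suc.IH[of c] by (intro cong_add) simp_all
    finally show ?thesis
      by (simp add: Suc add.commute)
  qed
qed

lemma fermat_theorem_power:
  fixes p a :: nat
  assumes "prime p"
  shows "[a ^ p = a] (mod p)"
proof (cases "p dvd a")
  case True
  then have "p dvd a ^ p"
    using prime_gt_0_nat[OF assms] dvd_power[of p a] dvd_trans by blast
  with True show ?thesis
    by (simp add: cong_def dvd_eq_mod_eq_0)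
next
  case False
  have "[a * a ^ (p - 1) = a * 1] (mod p)"
    by (intro cong_mult cong_refl fermat_theorem assms False)
  then show ?thesis
    using prime_gt_0_nat[OF assms] by (simp flip: power_Suc)
qed

theorem theorem2p1:
  fixes n k p :: nat
  assumes "prime p" and "odd p" and "n = 2 ^ k * p"
  shows "[(2 * n) choose n = 2 ^ n] (mod n) \<longleftrightarrow>
    int p dvd int (2 ^ (k + 1) choose 2 ^ k) - 2 ^ (2 ^ k) \<and> k \<le> binary_ones p"
proof -
  let ?c = "2 * n choose n"
  have "coprime (2 ^ k) p"
    using \<open>odd p\<close> by simp
  then have split: "[?c = 2 ^ n] (mod n) \<longleftrightarrow> [?c = 2 ^ n] (mod p) \<and> [?c = 2 ^ n] (mod 2 ^ k)"
    unfolding assms(3)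
    by (metis coprime_cong_mult_nat cong_modulus_mult_nat mult.commute)
  have "[?c = 2 ^ (k + 1) choose 2 ^ k] (mod p)"
    using cong_choose_mult_prime[OF \<open>prime p\<close>, of "2 ^ (k + 1)" "2 ^ k"]
    by (simp add: assms(3) mult_ac)
  \<comment> \<open>Here \<open>2 ^ n\<close> is the \<open>p\<close>-th power of
    \<open>2 ^ 2 ^ k\<close>.\<close>
  moreover have "[2 ^ n = 2 ^ 2 ^ k] (mod p)"
    using fermat_theorem_power[OF \<open>prime p\<close>, of "2 ^ 2 ^ k"] by (simp add: assms(3) power_mult)
  ultimately have "[?c = 2 ^ n] (mod p) \<longleftrightarrow> [2 ^ (k + 1) choose 2 ^ k = 2 ^ 2 ^ k] (mod p)"
    by (simp add: cong_def)
  \<comment> \<open>Condition (a) is a signed difference, which truncated subtraction on naturals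
    would not express.\<close>
  also have "\<dots> \<longleftrightarrow> [int (2 ^ (k + 1) choose 2 ^ k) = int (2 ^ 2 ^ k)] (mod int p)"
    by (rule cong_int_iff[symmetric])
  also have "\<dots> \<longleftrightarrow> int p dvd int (2 ^ (k + 1) choose 2 ^ k) - 2 ^ (2 ^ k)"
    by (simp add: cong_iff_dvd_diff)
  finally have mod_p: "[?c = 2 ^ n] (mod p) \<longleftrightarrow>
    int p dvd int (2 ^ (k + 1) choose 2 ^ k) - 2 ^ (2 ^ k)" .
  \<comment> \<open>The factor 1 reduces the comparison with \<open>n = 2 ^ k * p\<close> to
    \<open>1 \<le> p\<close>.\<close>
  have "k \<le> 2 ^ k * 1"
    using less_exp[of k] by simp
  also have "\<dots> \<le> n"
    unfolding assms(3) using prime_gt_0_nat[OF \<open>prime p\<close>] by (intro mult_le_mono2) simp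
  finally have "(2 :: nat) ^ k dvd 2 ^ n"
    by (rule le_imp_power_dvd)
  then have "[?c = 2 ^ n] (mod 2 ^ k) \<longleftrightarrow> 2 ^ k dvd ?c"
    by (simp add: cong_def dvd_eq_mod_eq_0)
  also have "\<dots> \<longleftrightarrow> k \<le> multiplicity 2 ?c"
    by (rule power_dvd_iff_le_multiplicity) simp_all
  \<comment> \<open>The factor \<open>2 ^ k\<close> of \<open>n\<close> only appends zeros to the
    expansion of \<open>p\<close>.\<close>
  also have "multiplicity 2 ?c = binary_ones p"
    by (simp add: multiplicity_2_central_binomial assms(3) binary_ones_power_mult)
  finally show ?thesis
    using split mod_p by simp
qed

end
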